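(* Let $I\subset\mathbb{R}$ be an interval, let $f:I\to\mathbb{R}$ be differentiable on the interior $I^{\circ}$ with $f'\in L[a,b]$, where $a,b\in I^{\circ}$, $a<b$. If $|f'|^{q}$ is quasi-convex on $[a,b]$ for some $q\ge 1$, then $$\left|\frac{f(a)+f(b)}{2}-\frac{1}{b-a}\int_a^b f(x)\,dx\right|\le \frac{b-a}{4}\left(\sup\{|f'(a)|^q,|f'(b)|^q\}\right)^{1/q}.$$
   Context: A function $g:[a,b]\to\mathbb{R}$ is quasi-convex on $[a,b]$ if $g(tx+(1-t)y)\le\sup\{g(x),g(y)\}$ for all $x,y\in[a,b]$ and $t\in[0,1]$. $L[a,b]$ denotes the set of Lebesgue integrable functions on $[a,b]$. *)

theory Defs
  imports "HOL-Analysis.Analysis"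
begin

definition quasi_convex_on :: "real \<Rightarrow> real \<Rightarrow> (real \<Rightarrow> real) \<Rightarrow> bool" where
  "quasi_convex_on a b g \<longleftrightarrow>
    (\<forall>x\<in>{a..b}. \<forall>y\<in>{a..b}. \<forall>t\<in>{0..1}. g (t * x + (1 - t) * y) \<le> Sup {g x, g y})"

end

theory Submission
  imports Defs
begin

text \<open>Quasi-convexity bounds the derivative on the interval by its values at the end points, so
  the function is Lipschitz there. On the left half of the interval the function is compared with
  its value at the left end point, on the right half with its value at the right end point; each
  half contributes at most \<open>M * (b - a)\<^sup>2 / 8\<close> to the error, where \<open>M\<close> is the Lipschitz
  constant.\<close>

text \<open>Every point of the interval is a convex combination of \<open>a\<close> and
  \<open>b\<close>, so the defining inequality can be applied to the end points themselves.\<close>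

lemma quasi_convex_on_le_endpoints:
  assumes "quasi_convex_on a b g" "x \<in> {a..b}"
  shows "g x \<le> Sup {g a, g b}"
proof -
  have "x \<in> closed_segment b a"
    using assms(2) by (auto simp: closed_segment_eq_real_ivl)
  then obtain t where t: "0 \<le> t" "t \<le> 1" "x = (1 - t) *\<^sub>R b + t *\<^sub>R a"
    by (auto simp: in_segment)
  have "g (t * a + (1 - t) * b) \<le> Sup {g a, g b}"
    using assms t(1,2) unfolding quasi_convex_on_def by auto
  then show ?thesis
    using t(3) by (simp add: add.commute)
qed

text \<open>The integrand differs from \<open>f c\<close> by at most \<open>M\<close> times the
  distance to \<open>c\<close>, and the distance to an end point integrates to half the squared
  length.\<close>

lemma lipschitz_endpoint_quadrature_error:
  fixes f :: "real \<Rightarrow> real"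
  assumes lip: "M-lipschitz_on {u..v} f" and "u \<le> v" and c: "c = u \<or> c = v"
  shows "\<bar>integral {u..v} f - (v - u) * f c\<bar> \<le> M * (v - u)\<^sup>2 / 2"
proof -
  \<comment> \<open>The sign \<open>s\<close> turns \<open>s * (x - c)\<close> into the distance
    from \<open>x\<close> to \<open>c\<close> on the whole interval, so the bound has a polynomial
    antiderivative.\<close>
  define s :: real where "s = (if c = u then 1 else - 1)"
  have f_int: "f integrable_on {u..v}"
    by (intro integrable_continuous_real lipschitz_on_continuous_on[OF lip])
  have bound_int: "((\<lambda>x. M * (s * (x - c))) has_integral M * (v - u)\<^sup>2 / 2) {u..v}"
  proof -
    have "((\<lambda>x. M * (s * (x - c))) has_integral
        M * s * (v - c)\<^sup>2 / 2 - M * s * (u - c)\<^sup>2 / 2) {u..v}"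
      using \<open>u \<le> v\<close> by (intro fundamental_theorem_of_calculus)
        (auto simp flip: has_real_derivative_iff_has_vector_derivative
          intro!: derivative_eq_intros)
    \<comment> \<open>One of the two squares vanishes because \<open>c\<close> is an end point;
      \<open>s\<close> gives the other a positive sign.\<close>
    moreover have "M * s * (v - c)\<^sup>2 / 2 - M * s * (u - c)\<^sup>2 / 2 = M * (v - u)\<^sup>2 / 2"
      using c by (auto simp: s_def power2_commute)
    ultimately show ?thesis
      by simp
  qed
  have "norm (f x - f c) \<le> M * (s * (x - c))" if "x \<in> {u..v}" for x
  proof -
    have "dist (f x) (f c) \<le> M * dist x c"
      using c \<open>u \<le> v\<close> that by (intro lipschitz_onD[OF lip]) auto
    moreover have "dist x c = s * (x - c)"
      using c that by (auto simp: s_def dist_real_def)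
    ultimately show ?thesis
      by (simp add: dist_norm)
  qed
  then have "norm (integral {u..v} (\<lambda>x. f x - f c)) \<le> integral {u..v} (\<lambda>x. M * (s * (x - c)))"
    using f_int bound_int
    by (intro integral_norm_bound_integral integrable_diff) (auto simp: has_integral_iff)
  also have "\<dots> = M * (v - u)\<^sup>2 / 2"
    using bound_int by (rule integral_unique)
  also have "integral {u..v} (\<lambda>x. f x - f c) = integral {u..v} f - (v - u) * f c"
    using f_int \<open>u \<le> v\<close> by (subst integral_diff) auto
  finally show ?thesis
    by simp
qed

lemma lipschitz_trapezoid_error:
  fixes f :: "real \<Rightarrow> real"
  assumes lip: "M-lipschitz_on {a..b} f" and "a < b"
  shows "\<bar>(f a + f b) / 2 - 1 / (b - a) * integral {a..b} f\<bar> \<le> (b - a) / 4 * M"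
proof -
  \<comment> \<open>Cutting at the midpoint gives \<open>f a\<close> and \<open>f b\<close> equal
    weights \<open>(b - a) / 2\<close>, so the two rectangles together have the area of the
    trapezoid.\<close>
  define m where "m = (a + b) / 2"
  have m: "a \<le> m" "m \<le> b" "m - a = (b - a) / 2" "b - m = (b - a) / 2"
    using \<open>a < b\<close> by (auto simp: m_def field_simps)
  have "\<bar>integral {a..m} f - (m - a) * f a\<bar> \<le> M * (m - a)\<^sup>2 / 2"
    using m(1,2) by (intro lipschitz_endpoint_quadrature_error lipschitz_on_subset[OF lip]) auto
  moreover have "\<bar>integral {m..b} f - (b - m) * f b\<bar> \<le> M * (b - m)\<^sup>2 / 2"
    using m(1,2) by (intro lipschitz_endpoint_quadrature_error lipschitz_on_subset[OF lip]) auto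
  moreover have "M * (m - a)\<^sup>2 / 2 + M * (b - m)\<^sup>2 / 2 = M * (b - a)\<^sup>2 / 4"
    unfolding m(3,4) by (simp add: power_divide)
  moreover have "(m - a) * f a + (b - m) * f b = (b - a) * ((f a + f b) / 2)"
    unfolding m(3,4) by (simp add: field_simps)
  moreover have "integral {a..m} f + integral {m..b} f = integral {a..b} f"
    using m lip by (intro Henstock_Kurzweil_Integration.integral_combine
        integrable_continuous_real lipschitz_on_continuous_on)
  ultimately have "\<bar>(b - a) * ((f a + f b) / 2) - integral {a..b} f\<bar> \<le> M * (b - a)\<^sup>2 / 4"
    by linarith
  also have "(b - a) * ((f a + f b) / 2) - integral {a..b} f
      = (b - a) * ((f a + f b) / 2 - 1 / (b - a) * integral {a..b} f)"
    using \<open>a < b\<close> by (simp add: right_diff_distrib)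
  finally have "(b - a) * \<bar>(f a + f b) / 2 - 1 / (b - a) * integral {a..b} f\<bar>
      \<le> (b - a) * ((b - a) / 4 * M)"
    using \<open>a < b\<close> by (simp add: abs_mult power2_eq_square mult_ac)
  then show ?thesis
    using \<open>a < b\<close> by simp
qed

theorem corollary4:
  fixes I :: "real set" and f :: "real \<Rightarrow> real" and a b q :: real
  assumes "is_interval I"
    and "\<And>x. x \<in> interior I \<Longrightarrow> f differentiable (at x)"
    and "a \<in> interior I" and "b \<in> interior I" and "a < b"
    and "set_integrable lebesgue {a..b} (deriv f)"
    and "q \<ge> 1"
    and "quasi_convex_on a b (\<lambda>x. \<bar>deriv f x\<bar> powr q)"
  shows "\<bar>(f a + f b) / 2 - 1 / (b - a) * (LINT x:{a..b}|lebesgue. f x)\<bar>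
    \<le> (b - a) / 4 * (Sup {\<bar>deriv f a\<bar> powr q, \<bar>deriv f b\<bar> powr q}) powr (1 / q)"
proof -
  define M where "M = (Sup {\<bar>deriv f a\<bar> powr q, \<bar>deriv f b\<bar> powr q}) powr (1 / q)"
  \<comment> \<open>Convexity puts all of \<open>{a..b}\<close> inside the interior, so
    \<open>f\<close> has a two-sided derivative even at \<open>a\<close> and
    \<open>b\<close>.\<close>
  have "convex (interior I)"
    using assms(1) by (simp add: convex_interior is_interval_convex)
  then have sub: "{a..b} \<subseteq> interior I"
    using assms(3,4) closed_segment_subset[of a "interior I" b] \<open>a < b\<close>
    by (simp add: closed_segment_eq_real_ivl)
  have deriv_le: "\<bar>deriv f x\<bar> \<le> M" if "x \<in> {a..b}" for x
  proof -
    \<comment> \<open>Monotonicity of the power \<open>1 / q\<close> carries the bound from the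
      \<open>q\<close>-th power of the derivative to the derivative itself.\<close>
    have "\<bar>deriv f x\<bar> = (\<bar>deriv f x\<bar> powr q) powr (1 / q)"
      using \<open>q \<ge> 1\<close> by (simp add: powr_powr)
    also have "\<dots> \<le> M"
      unfolding M_def
      using quasi_convex_on_le_endpoints[OF assms(8) that] \<open>q \<ge> 1\<close> by (intro powr_mono2) auto
    finally show ?thesis .
  qed
  have lip: "M-lipschitz_on {a..b} f"
  proof (rule bounded_derivative_imp_lipschitz)
    fix x assume "x \<in> {a..b}"
    then have "f differentiable (at x)"
      using assms(2) sub by blast
    then have "(f has_real_derivative deriv f x) (at x)"
      using DERIV_deriv_iff_real_differentiable by blast
    then show "(f has_derivative (*) (deriv f x)) (at x within {a..b})"
      unfolding has_field_derivative_def by (rule has_derivative_at_withinI)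
  next
    fix x assume "x \<in> {a..b}"
    then show "onorm ((*) (deriv f x)) \<le> M"
      using deriv_le by (intro onorm_le) (simp add: abs_mult mult_right_mono)
  qed (auto simp: M_def)
  \<comment> \<open>The error estimate concerns the Henstock-Kurzweil integral; continuity of
    \<open>f\<close> makes it agree with the Lebesgue integral of the statement.\<close>
  have "set_integrable lebesgue {a..b} f"
    using lipschitz_on_continuous_on[OF lip] by (rule absolutely_integrable_continuous_real)
  then have "(LINT x:{a..b}|lebesgue. f x) = integral {a..b} f"
    by (rule set_lebesgue_integral_eq_integral)
  then show ?thesis
    using lipschitz_trapezoid_error[OF lip \<open>a < b\<close>] by (simp add: M_def)
qed

end
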